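(* For all integers $m\ge 336$, $b(m)=\lfloor m/2\rfloor+1$. That is: every connected bipartite graph with $m$ vertices in each part and minimum degree at least $\lfloor m/2\rfloor+1$ is Class 0, and there exists a connected bipartite graph with $m$ vertices in each part and minimum degree at least $\lfloor m/2\rfloor$ that is not Class 0.
   Context: Let $G=(V,E)$ be a connected graph. A configuration $C$ of pebbles on $G$ is a function $C:V\to\mathbb{Z}_{\ge 0}$ (the number of pebbles on each vertex); its size is $|C|=\sum_{v\in V}C(v)$. A pebbling step from a vertex $u$ to an adjacent vertex $v$ removes two pebbles from $u$ and adds one pebble to $v$. A configuration is $r$-solvable if a pebble can be placed on the root vertex $r$ via a (possibly empty) sequence of pebbling steps, and solvable if it is $r$-solvable for every $r\in V$. The pebbling number $\pi(G)$ is the least $t$ such that every configuration of size $t$ on $G$ is solvable. A graph $G$ is Class 0 if $\pi(G)=|V(G)|$. Let $\mathbf{B}(m)$ denote the set of all connected bipartite graphs with $m$ vertices in each part, and let $b(m)$ be the minimum number $b$ such that every $G\in\mathbf{B}(m)$ having minimum degree at least $b$ is Class 0. *)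

theory Defs
  imports "Graph_Theory.Graph_Theory"
begin

(* Simple graphs are rendered as finite loopless symmetric digraphs without parallel
   arcs (locale pair_graph): an undirected edge uv is the pair of arcs (u,v), (v,u). *)

(* A configuration on G is a function 'a => nat of which only the values on pverts G
   matter: its size, the pebbling steps and solvability never consult other values. *)

definition config_size :: "'a pair_pre_digraph \<Rightarrow> ('a \<Rightarrow> nat) \<Rightarrow> nat" where
  "config_size G C = (\<Sum>v\<in>pverts G. C v)"

definition pebbling_step :: "'a pair_pre_digraph \<Rightarrow> ('a \<Rightarrow> nat) \<Rightarrow> ('a \<Rightarrow> nat) \<Rightarrow> bool" where
  "pebbling_step G C D \<longleftrightarrow>
     (\<exists>u v. (u, v) \<in> parcs G \<and> 2 \<le> C u \<and> D = C(u := C u - 2, v := C v + 1))"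

definition r_solvable :: "'a pair_pre_digraph \<Rightarrow> 'a \<Rightarrow> ('a \<Rightarrow> nat) \<Rightarrow> bool" where
  "r_solvable G r C \<longleftrightarrow> (\<exists>D. (pebbling_step G)\<^sup>*\<^sup>* C D \<and> 1 \<le> D r)"

definition solvable :: "'a pair_pre_digraph \<Rightarrow> ('a \<Rightarrow> nat) \<Rightarrow> bool" where
  "solvable G C \<longleftrightarrow> (\<forall>r\<in>pverts G. r_solvable G r C)"

definition pebbling_number :: "'a pair_pre_digraph \<Rightarrow> nat" where
  "pebbling_number G = (LEAST t. \<forall>C. config_size G C = t \<longrightarrow> solvable G C)"

definition class_0 :: "'a pair_pre_digraph \<Rightarrow> bool" where
  "class_0 G \<longleftrightarrow> pebbling_number G = card (pverts G)"

definition conn_bipartite :: "nat \<Rightarrow> 'a pair_pre_digraph set" where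
  "conn_bipartite m = {G. pair_graph G \<and> connected (with_proj G) \<and>
     (\<exists>X Y. pverts G = X \<union> Y \<and> X \<inter> Y = {} \<and> card X = m \<and> card Y = m \<and>
            parcs G \<subseteq> X \<times> Y \<union> Y \<times> X)}"

(* By symmetry of the arc relation, the out-degree is the number of neighbours. *)
definition min_degree :: "'a pair_pre_digraph \<Rightarrow> nat" where
  "min_degree G = Min (out_degree (with_proj G) ` pverts G)"

(* The number b(m). Every finite graph is isomorphic to one whose vertices are
   natural numbers, so it suffices to let G range over graphs on nat. *)
definition class_0_threshold :: "nat \<Rightarrow> nat" where
  "class_0_threshold m = (LEAST b. \<forall>G :: nat pair_pre_digraph.
     G \<in> conn_bipartite m \<and> b \<le> min_degree G \<longrightarrow> class_0 G)"

end

theory Submission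
  imports Defs
begin

text \<open>Fix a root \<open>r\<close> in the part \<open>X\<close> and a configuration of \<open>2 m\<close> pebbles from which \<open>r\<close> cannot be
  reached. Four pebbles on a vertex of \<open>X\<close> reach \<open>r\<close>, and since any two vertices of the same part have
  a common neighbour, double counting bounds the number \<open>U\<close> of available moves by \<open>12\<close>. The number
  of empty vertices is at most \<open>2 U\<close>, so almost every vertex carries exactly one pebble. Two
  moves starting at distance three from \<open>r\<close> can then be routed through pebbled vertices to one
  common neighbour of \<open>r\<close>; if \<open>U = 1\<close>, then \<open>r\<close> and at most one further vertex are empty and a
  single move can be routed to a pebbled neighbour of \<open>r\<close>.

  For the lower bound, two complete bipartite blocks are joined by a bridge. Three pebbles on the
  bridge end of one block, none on the other bridge end and on a root in the other block, and one
  pebble everywhere else, is unsolvable because only one pebble ever crosses.\<close>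

section \<open>Pebbling moves\<close>

lemma r_solvable_step:
  assumes "pebbling_step G C D" "r_solvable G r D"
  shows "r_solvable G r C"
  using assms unfolding r_solvable_def by (meson converse_rtranclp_into_rtranclp)

lemma r_solvableI: "1 \<le> C r \<Longrightarrow> r_solvable G r C"
  unfolding r_solvable_def by blast

lemma r_solvable_move:
  assumes "(u, v) \<in> parcs G" "u \<noteq> v" "2 * k \<le> C u"
    and "r_solvable G r (C(u := C u - 2 * k, v := C v + k))"
  shows "r_solvable G r C"
  using assms
proof (induction k arbitrary: C)
  case 0
  then show ?case by simp
next
  case (Suc k)
  let ?D = "C(u := C u - 2, v := C v + 1)"
  have "pebbling_step G C ?D"
    unfolding pebbling_step_def using Suc.prems by (intro exI[of _ u] exI[of _ v]) auto
  moreover have "r_solvable G r ?D"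
  proof (rule Suc.IH)
    have "C(u := C u - 2 * Suc k, v := C v + Suc k)
        = ?D(u := ?D u - 2 * k, v := ?D v + k)" (is "?E = ?F")
      using Suc.prems by (auto simp: fun_eq_iff)
    with Suc.prems(4) show "r_solvable G r ?F"
      by (rule back_subst)
  qed (use Suc.prems(1-3) in auto)
  ultimately show ?case by (rule r_solvable_step)
qed

text \<open>Continuation form: each vertex of \<open>S\<close> sends as many pebbles to
  \<open>v\<close> as it can, and afterwards only \<open>v\<close> and the vertices outside
  \<open>insert v S\<close> are recorded. The remainders on \<open>S\<close> stay unspecified, since
  later arguments continue from \<open>v\<close> and from vertices kept out of
  \<open>S\<close>.\<close>

lemma r_solvable_gather:
  assumes "finite S" "\<And>u. u \<in> S \<Longrightarrow> (u, v) \<in> parcs G" "v \<notin> S"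
    and "\<And>D. \<lbrakk>\<And>w. w \<notin> insert v S \<Longrightarrow> D w = C w; D v = C v + (\<Sum>u\<in>S. C u div 2)\<rbrakk>
           \<Longrightarrow> r_solvable G r D"
  shows "r_solvable G r C"
  using assms
proof (induction S arbitrary: C rule: finite_induct)
  case empty
  then show ?case by simp
next
  case (insert a S)
  let ?C = "C(a := C a - 2 * (C a div 2), v := C v + C a div 2)"
  have "r_solvable G r ?C"
  proof (rule insert.IH)
    fix D assume D: "\<And>w. w \<notin> Set.insert v S \<Longrightarrow> D w = ?C w"
      "D v = ?C v + (\<Sum>u\<in>S. ?C u div 2)"
    have "(\<Sum>u\<in>S. ?C u div 2) = (\<Sum>u\<in>S. C u div 2)"
      using insert.hyps insert.prems(2) by (intro sum.cong) auto
    then show "r_solvable G r D"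
      using D insert.hyps insert.prems(2) by (intro insert.prems(3)) auto
  qed (use insert.prems(1,2) in auto)
  then show ?case
    by (rule r_solvable_move[rotated 3]) (use insert.prems(1,2) in auto)
qed

text \<open>Each arc of a walk halves the number of pebbles carried along it, so
  \<open>2 ^ k\<close> pebbles shrink to one after \<open>k\<close> arcs.\<close>

lemma r_solvable_relpow:
  assumes "(u, v) \<in> parcs G ^^ k" "2 ^ k \<le> C u" and no_loop: "\<And>w. (w, w) \<notin> parcs G"
  shows "r_solvable G v C"
  using assms(1,2)
proof (induction k arbitrary: u C)
  case 0
  then show ?case by (auto intro: r_solvableI)
next
  case (Suc k)
  then obtain w where w: "(u, w) \<in> parcs G" "(w, v) \<in> parcs G ^^ k"
    by (meson relpow_Suc_D2)
  have "r_solvable G v (C(u := C u - 2 * 2 ^ k, w := C w + 2 ^ k))"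
    by (rule Suc.IH[OF w(2)]) simp
  then show ?case
    by (rule r_solvable_move[rotated 3]) (use w(1) no_loop Suc.prems(2) in auto)
qed

section \<open>Class 0 graphs\<close>

text \<open>Ensures that the \<open>LEAST\<close> in \<open>pebbling_number\<close> is an attained
  minimum.\<close>

lemma connected_has_solvable_size:
  fixes G :: "'a pair_pre_digraph"
  assumes "pair_graph G" "connected (with_proj G)"
  shows "\<exists>t. \<forall>C. config_size G C = t \<longrightarrow> solvable G C"
proof -
  interpret pair_graph G by fact
  have fin: "finite (pverts G)" by (rule pair_finite_verts)
  have "\<exists>k. (u, v) \<in> parcs G ^^ k" if "u \<in> pverts G" "v \<in> pverts G" for u v
  proof -
    have "u \<rightarrow>\<^sup>*\<^bsub>with_proj G\<^esub> v"
      using symmetric_connected_imp_strongly_connected[OF pair_sym_arcs assms(2)] that by auto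
    then have "(u, v) \<in> (parcs G)\<^sup>*"
      by (auto dest: reachable_rtranclI)
    then show ?thesis by (simp add: rtrancl_power)
  qed
  then obtain d where d: "\<And>u v. u \<in> pverts G \<Longrightarrow> v \<in> pverts G \<Longrightarrow> (u, v) \<in> parcs G ^^ d u v"
    by metis
  define K where "K = Max ((\<lambda>(u, v). d u v) ` (pverts G \<times> pverts G))"
  have K: "d u v \<le> K" if "u \<in> pverts G" "v \<in> pverts G" for u v
    unfolding K_def using fin that by (intro Max_ge) auto
  \<comment> \<open>By pigeonhole, this size forces \<open>2 ^ K\<close> pebbles onto some vertex,
    which is enough for every walk length \<open>d u v\<close>.\<close>
  have "solvable G C" if C: "config_size G C = card (pverts G) * 2 ^ K" for C
    unfolding solvable_def
  proof
    fix r assume r: "r \<in> pverts G"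
    obtain u where u: "u \<in> pverts G" "2 ^ K \<le> C u"
    proof (rule ccontr)
      assume *: "\<not> thesis"
      then have "\<And>u. u \<in> pverts G \<Longrightarrow> C u < 2 ^ K"
        using that leI by blast
      then have "(\<Sum>u\<in>pverts G. C u) < (\<Sum>u\<in>pverts G. 2 ^ K)"
        using fin r by (intro sum_strict_mono) auto
      then show False using C unfolding config_size_def by simp
    qed
    have "(2::nat) ^ d u r \<le> 2 ^ K" using K[OF u(1) r] by (rule power_increasing) simp
    then have "2 ^ d u r \<le> C u" using u(2) by (rule order_trans)
    then show "r_solvable G r C"
      using d[OF u(1) r] u(2) pair_no_loops[of "(_, _)"]
      by (intro r_solvable_relpow[of u r "d u r"]) auto
  qed
  then show ?thesis by blast
qed

lemma not_r_solvable_if_at_most_one: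
  assumes "\<And>v. C v \<le> 1" "C r = 0"
  shows "\<not> r_solvable G r C"
proof
  assume "r_solvable G r C"
  then obtain D where "(pebbling_step G)\<^sup>*\<^sup>* C D" "1 \<le> D r"
    unfolding r_solvable_def by blast
  moreover have "\<not> pebbling_step G C D" for D
    unfolding pebbling_step_def using assms(1) by (metis not_less_eq_eq one_add_one plus_1_eq_Suc)
  ultimately have "C = D" by (metis converse_rtranclpE)
  then show False using \<open>1 \<le> D r\<close> assms(2) by simp
qed

text \<open>The pebbling number of a connected graph is never below the number of vertices: fewer
  pebbles can be placed singly on vertices other than \<open>r\<close>, and then no step is
  possible. Hence Class 0 only asks that the size \<open>card (pverts G)\<close> suffices.\<close>

lemma class_0_iff:
  fixes G :: "'a pair_pre_digraph"
  assumes "pair_graph G" "connected (with_proj G)"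
  shows "class_0 G \<longleftrightarrow> (\<forall>C. config_size G C = card (pverts G) \<longrightarrow> solvable G C)"
proof
  assume "class_0 G"
  then show "\<forall>C. config_size G C = card (pverts G) \<longrightarrow> solvable G C"
    using LeastI_ex[OF connected_has_solvable_size[OF assms]]
    unfolding class_0_def pebbling_number_def by (elim subst)
next
  interpret pair_graph G by fact
  have fin: "finite (pverts G)" by (rule pair_finite_verts)
  obtain r where r: "r \<in> pverts G"
    using assms(2) unfolding connected_def strongly_connected_def by auto
  assume all: "\<forall>C. config_size G C = card (pverts G) \<longrightarrow> solvable G C"
  have "card (pverts G) \<le> t" if t: "\<forall>C. config_size G C = t \<longrightarrow> solvable G C" for t
  proof (rule ccontr)
    assume "\<not> card (pverts G) \<le> t"
    then have "t \<le> card (pverts G - {r})" using r fin by simp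
    then obtain S where S: "S \<subseteq> pverts G - {r}" "card S = t"
      by (meson obtain_subset_with_card_n)
    let ?C = "\<lambda>v. if v \<in> S then 1 else 0 :: nat"
    have "pverts G \<inter> S = S" using S(1) by auto
    then have "config_size G ?C = t"
      using S(2) fin by (simp add: config_size_def sum.If_cases)
    then have "solvable G ?C" using t by simp
    then have "r_solvable G r ?C" using r unfolding solvable_def by blast
    moreover have "r \<notin> S" using S(1) by blast
    ultimately show False
      using not_r_solvable_if_at_most_one[of ?C r G] by simp
  qed
  with all show "class_0 G"
    unfolding class_0_def pebbling_number_def by (intro Least_equality) auto
qed

section \<open>Dense bipartite graphs\<close>

definition nbrs :: "'a pair_pre_digraph \<Rightarrow> 'a \<Rightarrow> 'a set" where
  "nbrs G v = {u. (v, u) \<in> parcs G}"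

text \<open>The root is fixed in \<open>X\<close>; a root in \<open>Y\<close> is handled by
  interchanging the parts. The degree condition is the division-free form of a lower bound
  \<open>m div 2 + 1\<close>.\<close>

locale rooted_dense_bipartite =
  fixes G :: "'a pair_pre_digraph" and X Y :: "'a set" and m :: nat and r :: 'a
  assumes sym_arcs: "(u, v) \<in> parcs G \<Longrightarrow> (v, u) \<in> parcs G"
    and verts: "pverts G = X \<union> Y"
    and disjoint: "X \<inter> Y = {}"
    and card_X: "card X = m" and card_Y: "card Y = m"
    and arcs: "parcs G \<subseteq> X \<times> Y \<union> Y \<times> X"
    and root: "r \<in> X"
    and large: "336 \<le> m"
    and degree: "v \<in> X \<union> Y \<Longrightarrow> m < 2 * card (nbrs G v)"
begin

abbreviation N where "N \<equiv> nbrs G"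
abbreviation solv where "solv \<equiv> r_solvable G r"

definition Z :: "('a \<Rightarrow> nat) \<Rightarrow> 'a set" where
  "Z C = {v \<in> X \<union> Y. C v = 0}"

lemma mem_Z: "v \<in> Z C \<longleftrightarrow> v \<in> X \<union> Y \<and> C v = 0"
  by (simp add: Z_def)

lemma finite_X: "finite X" and finite_Y: "finite Y"
  using card_X card_Y large by (auto intro: card_ge_0_finite)

lemma N_X: "x \<in> X \<Longrightarrow> N x \<subseteq> Y" and N_Y: "y \<in> Y \<Longrightarrow> N y \<subseteq> X"
  using arcs disjoint by (auto simp: nbrs_def)

lemma N_sym: "v \<in> N u \<longleftrightarrow> u \<in> N v"
  using sym_arcs by (auto simp: nbrs_def)

lemma N_neq: "v \<in> N u \<Longrightarrow> u \<noteq> v"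
  using arcs disjoint by (auto simp: nbrs_def)

lemma finite_N: "v \<in> X \<union> Y \<Longrightarrow> finite (N v)"
  using finite_subset[OF N_X finite_Y] finite_subset[OF N_Y finite_X] by blast

lemma finite_Z: "finite (Z C)"
  using finite_X finite_Y by (simp add: Z_def)

lemma X_notin_Y: "x \<in> X \<Longrightarrow> y \<in> Y \<Longrightarrow> x \<noteq> y"
  using disjoint by blast

lemma move:
  assumes "v \<in> N u" "2 * k \<le> C u" "solv (C(u := C u - 2 * k, v := C v + k))"
  shows "solv C"
  using r_solvable_move assms N_neq by (metis mem_Collect_eq nbrs_def)

lemma gather:
  assumes "finite S" "S \<subseteq> N v"
    and "\<And>D. \<lbrakk>\<And>w. w \<notin> insert v S \<Longrightarrow> D w = C w; D v = C v + (\<Sum>u\<in>S. C u div 2)\<rbrakk> \<Longrightarrow> solv D"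
  shows "solv C"
proof (rule r_solvable_gather[of S v G C r])
  show "\<And>u. u \<in> S \<Longrightarrow> (u, v) \<in> parcs G" using assms(2) sym_arcs by (auto simp: nbrs_def)
  show "v \<notin> S" using assms(2) N_neq by blast
qed (use assms(1,3) in auto)

section \<open>Short routes to the root\<close>

text \<open>By inclusion-exclusion, two neighbourhoods with more than \<open>m / 2\<close> vertices
  each inside a part of size \<open>m\<close> must overlap.\<close>

lemma common_nbr:
  assumes "u \<in> X \<and> v \<in> X \<or> u \<in> Y \<and> v \<in> Y"
  obtains w where "w \<in> N u" "w \<in> N v"
proof -
  obtain W where W: "finite W" "card W = m" "N u \<subseteq> W" "N v \<subseteq> W"
    using assms N_X N_Y finite_X finite_Y card_X card_Y by metis
  have "card (N u) + card (N v) = card (N u \<union> N v) + card (N u \<inter> N v)"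
    using W by (intro card_Un_Int) (auto intro: finite_subset)
  moreover have "card (N u \<union> N v) \<le> m"
    using W by (metis Un_least card_mono)
  moreover have "m < 2 * card (N u)" "m < 2 * card (N v)"
    using assms degree by auto
  ultimately have "card (N u \<inter> N v) \<noteq> 0" by linarith
  then have "N u \<inter> N v \<noteq> {}" by force
  then show ?thesis using that by blast
qed

lemma solv_two:
  assumes "y \<in> N r" "2 \<le> C y"
  shows "solv C"
proof (rule move[of r y 1])
  show "r \<in> N y" using assms(1) N_sym by simp
  show "solv (C(y := C y - 2 * 1, r := C r + 1))" by (rule r_solvableI) simp
qed (use assms in auto)

lemma solv_two_one:
  assumes "y \<in> N x" "y \<in> N r" "2 \<le> C x" "1 \<le> C y"
  shows "solv C"
proof (rule move[of y x 1])
  show "solv (C(x := C x - 2 * 1, y := C y + 1))"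
    by (rule solv_two[of y]) (use assms N_neq[of y x] in auto)
qed (use assms in auto)

lemma solv_four:
  assumes "x \<in> X" "4 \<le> C x"
  shows "solv C"
proof -
  obtain y where y: "y \<in> N x" "y \<in> N r"
    using common_nbr assms(1) root by blast
  show ?thesis
  proof (rule move[of y x 2])
    show "solv (C(x := C x - 2 * 2, y := C y + 2))"
      by (rule solv_two[of y]) (use y N_neq[of y x] in auto)
  qed (use assms y in auto)
qed

text \<open>A single move can start at distance three from \<open>r\<close> if the route is pebbled:
  the pebbles on \<open>x\<close> and \<open>y\<close> complete each arriving pebble to a
  pair.\<close>

lemma solv_from_far:
  assumes "w \<in> Y - N r" "x \<in> N w" "y \<in> N x" "y \<in> N r" "2 \<le> C w" "1 \<le> C x" "1 \<le> C y"
  shows "solv C"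
proof (rule move[of x w 1])
  have "x \<in> X" "y \<in> Y" using assms N_Y N_X root by auto
  then have "x \<noteq> y" "w \<noteq> y" "x \<noteq> w" using assms X_notin_Y by auto
  then show "solv (C(w := C w - 2 * 1, x := C x + 1))"
    by (intro solv_two_one[of y x]) (use assms in auto)
qed (use assms in auto)

lemma card_diff_Z: "card (N v) \<le> card (N v - Z C) + card (Z C)"
  using diff_card_le_card_Diff[OF finite_Z, of "N v" C] by simp

text \<open>If no pebble can be doubled next to the root, every positive vertex of \<open>N w \<union> N w'\<close> has only
  empty neighbours in \<open>N r\<close>. A positive vertex of \<open>N r\<close> then has its more than \<open>m / 2\<close> neighbours
  elsewhere, so \<open>N w\<close> and \<open>N w'\<close> are confined to less than half of \<open>X\<close> and almost coincide. By
  the pigeonhole principle two of their common vertices share an empty neighbour in \<open>N r\<close>.\<close>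

lemma solv_two_far:
  assumes w: "w \<in> Y - N r" "w' \<in> Y - N r" "2 \<le> C w" "2 \<le> C w'" "w = w' \<Longrightarrow> 4 \<le> C w"
    and few: "card (Z C) \<le> 26"
  shows "solv C"
proof (rule ccontr)
  assume uns: "\<not> solv C"
  define Q Q' where "Q = N w - Z C" and "Q' = N w' - Z C"
  have QX: "Q \<subseteq> X" "Q' \<subseteq> X" using w(1,2) N_Y unfolding Q_def Q'_def by auto
  have pos: "1 \<le> C x" if "x \<in> Q \<union> Q'" for x
    using that QX unfolding Q_def Q'_def by (auto simp: mem_Z not_less_eq_eq)
  have zero: "y \<in> Z C" if xy: "x \<in> Q \<union> Q'" "y \<in> N x" "y \<in> N r" for x y
  proof (rule ccontr)
    assume "y \<notin> Z C"
    moreover have "y \<in> Y" using xy(3) N_X root by blast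
    ultimately have "1 \<le> C y" by (auto simp: mem_Z)
    moreover obtain v where "v \<in> Y - N r" "2 \<le> C v" "x \<in> N v"
      using xy(1) w(1-4) unfolding Q_def Q'_def by blast
    ultimately show False
      using solv_from_far[of v x y C] uns xy(2,3) pos[OF xy(1)] by blast
  qed
  have "card (N r) > 26" using degree[of r] root large by simp
  then have "card (N r - Z C) \<noteq> 0"
    using few card_diff_Z[of r C] by linarith
  then have "N r - Z C \<noteq> {}" by force
  then obtain y where y: "y \<in> N r" "y \<notin> Z C" by blast
  then have yY: "y \<in> Y" using N_X root by blast
  have "N y \<inter> (Q \<union> Q') = {}"
    using zero[OF _ _ y(1)] y(2) N_sym[of _ y] by auto
  then have "card (N y) + card (Q \<union> Q') = card (N y \<union> (Q \<union> Q'))"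
    using yY finite_N QX finite_X by (intro card_Un_disjoint[symmetric]) (auto intro: finite_subset)
  also have "\<dots> \<le> m"
    using card_mono[OF finite_X] N_Y[OF yY] QX card_X by (metis Un_least)
  finally have "card (N y) + card (Q \<union> Q') \<le> m" .
  moreover have "card Q + card Q' = card (Q \<union> Q') + card (Q \<inter> Q')"
    using QX finite_X by (intro card_Un_Int) (auto intro: finite_subset)
  moreover have "card (N w) \<le> card Q + card (Z C)" "card (N w') \<le> card Q' + card (Z C)"
    unfolding Q_def Q'_def by (rule card_diff_Z)+
  moreover have "m < 2 * card (N y)" "m < 2 * card (N w)" "m < 2 * card (N w')"
    using degree yY w(1,2) by auto
  \<comment> \<open>The three degree bounds leave more than \<open>m / 2 - 2 * card (Z C)\<close>
    common vertices, which exceeds \<open>card (Z C)\<close> by the bounds 26 and 336.\<close>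
  ultimately have big: "card (Z C) < card (Q \<inter> Q')"
    using few large by linarith
  have "\<exists>y. y \<in> N x \<and> y \<in> N r" if "x \<in> Q \<inter> Q'" for x
    using common_nbr[of x r] root that QX by blast
  then obtain g where g: "\<And>x. x \<in> Q \<inter> Q' \<Longrightarrow> g x \<in> N x \<and> g x \<in> N r" by metis
  have "g ` (Q \<inter> Q') \<subseteq> Z C" using zero g by blast
  then have "card (g ` (Q \<inter> Q')) < card (Q \<inter> Q')"
    using card_mono[OF finite_Z] big by (meson le_less_trans)
  then have "\<not> inj_on g (Q \<inter> Q')" by (rule pigeonhole)
  then obtain x x' where x: "x \<in> Q \<inter> Q'" "x' \<in> Q \<inter> Q'" "x \<noteq> x'" "g x = g x'"
    unfolding inj_on_def by blast
  let ?d = "g x"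
  have d: "?d \<in> N x" "?d \<in> N x'" "?d \<in> N r" using g[OF x(1)] g[OF x(2)] x(4) by auto
  have sides: "x \<in> X" "x' \<in> X" "?d \<in> Y" "w \<in> Y" "w' \<in> Y"
    using x(1,2) QX d(3) N_X[OF root] w(1,2) by auto
  have ne: "x \<noteq> w" "x \<noteq> w'" "x' \<noteq> w" "x' \<noteq> w'" "x \<noteq> ?d" "x' \<noteq> ?d"
    using sides X_notin_Y by blast+
  have wd: "w \<noteq> ?d" "w' \<noteq> ?d" using w(1,2) d by auto
  have adj: "x \<in> N w" "x' \<in> N w'" using x(1,2) unfolding Q_def Q'_def by auto
  have px: "1 \<le> C x" "1 \<le> C x'" using x(1,2) pos by blast+
  \<comment> \<open>The vertex \<open>?d\<close> is empty, so it needs one pebble from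
    \<open>x\<close> and one from \<open>x'\<close>; these become movable by one pebble each from
    \<open>w\<close> and \<open>w'\<close>.\<close>
  let ?C1 = "C(w := C w - 2 * 1, x := C x + 1)"
  let ?C2 = "?C1(w' := ?C1 w' - 2 * 1, x' := ?C1 x' + 1)"
  let ?C3 = "?C2(x := ?C2 x - 2 * 1, ?d := ?C2 ?d + 1)"
  \<comment> \<open>If \<open>w = w'\<close>, the four pebbles on that vertex pay for both
    moves.\<close>
  have c1: "2 \<le> ?C1 w'" using w(3,4,5) ne by (cases "w = w'") auto
  have c2: "2 \<le> ?C2 x" "2 \<le> ?C2 x'" using ne x(3) px by auto
  have c3: "2 \<le> ?C3 x'" "1 \<le> ?C3 ?d" using c2 ne x(3) by auto
  have "solv ?C3" using solv_two_one[of ?d x'] d c3 by blast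
  then have "solv ?C2" using move[of ?d x 1 ?C2] d c2 by simp
  then have "solv ?C1" using move[of x' w' 1 ?C1] adj c1 by simp
  then have "solv C" using move[of x w 1 C] adj w(3) by simp
  with uns show False by blast
qed

section \<open>Double counting of available moves\<close>

text \<open>The sum of \<open>card (N b) * f b\<close> over \<open>B\<close> is counted from both
  sides: degrees bound it below by \<open>(m + 1) / 2\<close> times \<open>sum f B\<close>, and the
  local bound \<open>k\<close> at each of the \<open>m\<close> vertices of \<open>A\<close> bounds
  it above.\<close>

lemma weight_bound:
  assumes sides: "A \<union> B \<subseteq> X \<union> Y" "\<And>b. b \<in> B \<Longrightarrow> N b \<subseteq> A" "card A = m"
    and le: "\<And>a. a \<in> A \<Longrightarrow> (\<Sum>b\<in>N a \<inter> B. f b) \<le> k"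
  shows "(m + 1) * sum f B \<le> 2 * k * m"
proof -
  have fin: "finite A" "finite B"
    using sides(1) finite_X finite_Y finite_subset by (metis finite_UnI le_sup_iff)+
  have "(\<Sum>b\<in>B. card (N b) * f b) = (\<Sum>b\<in>B. \<Sum>a | a \<in> A \<and> a \<in> N b. f b)"
  proof (rule sum.cong[OF refl])
    fix b assume "b \<in> B"
    then have "{a. a \<in> A \<and> a \<in> N b} = N b" using sides(2) by blast
    then show "card (N b) * f b = (\<Sum>a | a \<in> A \<and> a \<in> N b. f b)" by simp
  qed
  also have "\<dots> = (\<Sum>a\<in>A. \<Sum>b | b \<in> B \<and> a \<in> N b. f b)"
    by (rule sum.swap_restrict[OF fin(2,1)])
  also have "\<dots> = (\<Sum>a\<in>A. \<Sum>b\<in>N a \<inter> B. f b)"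
  proof (rule sum.cong[OF refl])
    fix a
    have "{b. b \<in> B \<and> a \<in> N b} = N a \<inter> B" using N_sym[of a] by blast
    then show "(\<Sum>b | b \<in> B \<and> a \<in> N b. f b) = (\<Sum>b\<in>N a \<inter> B. f b)" by simp
  qed
  also have "\<dots> \<le> k * m"
    using sum_bounded_above[of A "\<lambda>a. \<Sum>b\<in>N a \<inter> B. f b" k] le sides(3)
    by (simp add: mult.commute)
  finally have *: "(\<Sum>b\<in>B. card (N b) * f b) \<le> k * m" .
  have "(m + 1) * sum f B = (\<Sum>b\<in>B. (m + 1) * f b)" by (rule sum_distrib_left)
  also have "\<dots> \<le> (\<Sum>b\<in>B. 2 * card (N b) * f b)"
  proof (intro sum_mono mult_right_mono)
    fix b assume "b \<in> B"
    then show "m + 1 \<le> 2 * card (N b)" using degree[of b] sides(1) by auto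
  qed simp
  also have "\<dots> = 2 * (\<Sum>b\<in>B. card (N b) * f b)"
    by (simp add: sum_distrib_left mult.assoc)
  finally show ?thesis using * by simp
qed

lemma weight_less:
  assumes "(m + 1) * s \<le> 2 * k * m" "0 < k"
  shows "s < 2 * k"
proof (rule ccontr)
  assume "\<not> s < 2 * k"
  then have "(m + 1) * (2 * k) \<le> (m + 1) * s" by (intro mult_left_mono) auto
  with assms show False by (simp add: algebra_simps)
qed

text \<open>Four moves into one vertex \<open>x\<close> of \<open>X\<close> would allow
  \<open>solv_four\<close>, so the local bound is 3.\<close>

lemma far_weight:
  assumes "\<not> solv C"
  shows "(\<Sum>y\<in>Y - N r. C y div 2) < 6"
proof -
  have "(\<Sum>y\<in>N x \<inter> (Y - N r). C y div 2) \<le> 3" if x: "x \<in> X" for x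
  proof (rule ccontr)
    assume *: "\<not> ?thesis"
    have "solv C"
    proof (rule gather[of "N x \<inter> (Y - N r)" x])
      fix D assume "D x = C x + (\<Sum>u\<in>N x \<inter> (Y - N r). C u div 2)"
      then have "4 \<le> D x" using * by simp
      then show "solv D" by (rule solv_four[OF x])
    qed (use finite_Y in auto)
    with assms show False by blast
  qed
  then have "(m + 1) * (\<Sum>y\<in>Y - N r. C y div 2) \<le> 2 * 3 * m"
    using N_Y card_X by (intro weight_bound[of X]) auto
  then show ?thesis using weight_less[of _ 3] by simp
qed

text \<open>The local bound is 4. Given five moves into \<open>y\<close>, one movable neighbour
  \<open>x\<close> is held back; it accounts for only one of them because \<open>C x < 4\<close>.
  The others put four pebbles on \<open>y\<close>, and two moves from \<open>y\<close> raise
  \<open>x\<close> to four pebbles.\<close>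

lemma near_weight:
  assumes "\<not> solv C"
  shows "(\<Sum>x\<in>X. C x div 2) < 8"
proof -
  have "(\<Sum>x\<in>N y \<inter> X. C x div 2) \<le> 4" if y: "y \<in> Y" for y
  proof (rule ccontr)
    assume *: "\<not> ?thesis"
    have yX: "N y \<inter> X = N y" using N_Y[OF y] by blast
    have fin: "finite (N y)" using finite_N y by blast
    have "\<exists>x\<in>N y. C x div 2 \<noteq> 0"
    proof (rule ccontr)
      assume "\<not> ?thesis"
      then have "(\<Sum>x\<in>N y. C x div 2) = 0" by simp
      then show False using * yX by simp
    qed
    then obtain x where x: "x \<in> N y" "2 \<le> C x" by (auto simp: div_eq_0_iff not_less)
    then have xX: "x \<in> X" using N_Y[OF y] by blast
    then have "C x < 4" using solv_four assms not_less by blast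
    then have "C x div 2 \<le> 1" by simp
    moreover have "(\<Sum>x\<in>N y. C x div 2) = C x div 2 + (\<Sum>x\<in>N y - {x}. C x div 2)"
      using fin x(1) by (rule sum.remove)
    ultimately have rest: "4 \<le> (\<Sum>x\<in>N y - {x}. C x div 2)"
      using * yX by simp
    have xy: "x \<noteq> y" using N_neq[OF x(1)] by simp
    have "solv C"
    proof (rule gather[of "N y - {x}" y])
      fix D assume D: "\<And>w. w \<notin> insert y (N y - {x}) \<Longrightarrow> D w = C w"
        "D y = C y + (\<Sum>u\<in>N y - {x}. C u div 2)"
      have "D x = C x" using D(1) xy by blast
      moreover have "2 * 2 \<le> D y" using D(2) rest by simp
      moreover have "solv (D(y := D y - 2 * 2, x := D x + 2))"
        by (rule solv_four[OF xX]) (use \<open>D x = C x\<close> x(2) in simp)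
      ultimately show "solv D" using move[of x y 2 D] x(1) by blast
    qed (use fin in auto)
    with assms show False by blast
  qed
  then have "(m + 1) * (\<Sum>x\<in>X. C x div 2) \<le> 2 * 4 * m"
    using N_X card_Y by (intro weight_bound[of Y]) auto
  then show ?thesis using weight_less[of _ 4] by simp
qed

text \<open>The size equals the number of vertices, so each empty vertex is a deficit to be balanced
  by surplus elsewhere. A vertex with \<open>c > 0\<close> pebbles has surplus \<open>c - 1\<close>,
  at most twice \<open>c div 2\<close>.\<close>

lemma card_Z_le:
  assumes "config_size G C = 2 * m"
  shows "card (Z C) \<le> 2 * (\<Sum>v\<in>X \<union> Y. C v div 2)"
proof -
  let ?z = "\<lambda>v. if C v = 0 then 1 else 0 :: nat"
  have fin: "finite (X \<union> Y)" using finite_X finite_Y by simp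
  have "(\<Sum>v\<in>X \<union> Y. C v) = 2 * m" using assms unfolding config_size_def verts .
  moreover have "card (Z C) = (\<Sum>v\<in>X \<union> Y. ?z v)"
    using fin by (simp add: sum.If_cases Z_def Int_def)
  ultimately have "2 * m + card (Z C) = (\<Sum>v\<in>X \<union> Y. C v + ?z v)"
    by (simp add: sum.distrib)
  also have "\<dots> \<le> (\<Sum>v\<in>X \<union> Y. 1 + 2 * (C v div 2))"
    by (intro sum_mono) auto
  also have "\<dots> = 2 * m + 2 * (\<Sum>v\<in>X \<union> Y. C v div 2)"
    using finite_X finite_Y disjoint card_X card_Y
    by (simp add: sum.distrib card_Un_disjoint sum_distrib_left[symmetric] del: One_nat_def)
  finally show ?thesis by simp
qed

section \<open>Excluding vertices with two pebbles\<close>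

lemma near_nbrs_zero:
  assumes "\<not> solv C" "x \<in> X" "2 \<le> C x"
  shows "N x \<inter> N r \<subseteq> Z C"
proof
  fix y assume y: "y \<in> N x \<inter> N r"
  then have "y \<in> Y" using N_X root by blast
  moreover have "\<not> 1 \<le> C y" using solv_two_one[of y x C] y assms by blast
  ultimately show "y \<in> Z C" by (simp add: mem_Z)
qed

text \<open>Serves to shift a move from \<open>X\<close> to distance three from the root. More than
  one neighbour of \<open>x\<close> is pebbled, and none of these is adjacent to \<open>r\<close> by
  \<open>near_nbrs_zero\<close>; having two of them allows any given \<open>v\<close> to be
  avoided.\<close>

lemma far_nbr:
  assumes "\<not> solv C" "x \<in> X" "2 \<le> C x" "card (Z C) \<le> 24"
  obtains w where "w \<in> Y - N r" "w \<in> N x" "1 \<le> C w" "w \<noteq> v"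
proof -
  have "card (N x) \<le> card (N x - Z C) + card (Z C)" by (rule card_diff_Z)
  moreover have "m < 2 * card (N x)" using degree assms(2) by blast
  ultimately have "1 < card (N x - Z C)" using assms(4) large by linarith
  then have "\<not> card (N x - Z C) \<le> Suc 0" by simp
  moreover have "finite (N x - Z C)" using finite_N assms(2) by blast
  ultimately obtain w where w: "w \<in> N x - Z C" "w \<noteq> v"
    using card_le_Suc0_iff_eq by metis
  moreover have "w \<in> Y" using w(1) N_X assms(2) by blast
  moreover have "w \<notin> N r" using w(1) near_nbrs_zero[OF assms(1-3)] by blast
  moreover have "1 \<le> C w" using w(1) \<open>w \<in> Y\<close> by (auto simp: mem_Z)
  ultimately show ?thesis using that by blast
qed

text \<open>Only the source of a move can become newly empty. From at most 24 empty vertices, two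
  moves thus stay within the bound 26 of \<open>solv_two_far\<close>.\<close>

lemma card_Z_move: "card (Z (C(x := C x - k, w := C w + 1))) \<le> card (Z C) + 1"
proof -
  have "Z (C(x := C x - k, w := C w + 1)) \<subseteq> insert x (Z C)"
    by (auto simp: mem_Z split: if_splits)
  then have "card (Z (C(x := C x - k, w := C w + 1))) \<le> card (insert x (Z C))"
    using finite_Z by (intro card_mono) auto
  also have "\<dots> \<le> card (Z C) + 1"
    using card_insert_le_m1[of "card (Z C) + 1" "Z C" x] by simp
  finally show ?thesis .
qed

text \<open>Moving from \<open>x\<close> to a pebbled far neighbour \<open>w\<close> other than
  \<open>w'\<close> creates the second far pair that \<open>solv_two_far\<close> requires.\<close>

lemma big_near_far:
  assumes "\<not> solv C" "card (Z C) \<le> 24" "x \<in> X" "2 \<le> C x" "w' \<in> Y - N r" "2 \<le> C w'"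
  shows False
proof -
  obtain w where w: "w \<in> Y - N r" "w \<in> N x" "1 \<le> C w" "w \<noteq> w'"
    using far_nbr assms(1-4) by blast
  let ?C = "C(x := C x - 2 * 1, w := C w + 1)"
  have ne: "x \<noteq> w" "x \<noteq> w'" using X_notin_Y assms(3,5) w(1) by auto
  have "solv ?C"
  proof (rule solv_two_far[of w w'])
    show "card (Z ?C) \<le> 26" using card_Z_move[of C x 2 w] assms(2) by simp
  qed (use w assms ne in auto)
  then show False using move[of w x 1 C] w(2) assms(1,4) by simp
qed

text \<open>Both moves are shifted to distance three, with distinct targets \<open>w\<close> and
  \<open>w'\<close>.\<close>

lemma big_near_near:
  assumes "\<not> solv C" "card (Z C) \<le> 24" "x \<in> X" "2 \<le> C x" "x' \<in> X" "2 \<le> C x'" "x \<noteq> x'"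
  shows False
proof -
  obtain w where w: "w \<in> Y - N r" "w \<in> N x" "1 \<le> C w"
    using far_nbr assms(1-4) by blast
  obtain w' where w': "w' \<in> Y - N r" "w' \<in> N x'" "1 \<le> C w'" "w' \<noteq> w"
    using far_nbr assms(1,2,5,6) by blast
  let ?C = "C(x := C x - 2 * 1, w := C w + 1)"
  let ?D = "?C(x' := ?C x' - 2 * 1, w' := ?C w' + 1)"
  have ne: "x \<noteq> w" "x \<noteq> w'" "x' \<noteq> w" "x' \<noteq> w'" using X_notin_Y assms(3,5) w(1) w'(1) by auto
  have "solv ?D"
  proof (rule solv_two_far[of w w'])
    show "card (Z ?D) \<le> 26"
      using card_Z_move[of C x 2 w] card_Z_move[of ?C x' 2 w'] assms(2) by simp
    show "2 \<le> ?D w" "2 \<le> ?D w'" using w(3) w'(3,4) ne by auto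
  qed (use w(1) w'(1,4) in auto)
  then have "solv ?C" using move[of w' x' 1 ?C] w'(2) assms(6,7) ne by simp
  then show False using move[of w x 1 C] w(2) assms(1,4) by simp
qed

text \<open>One move from \<open>w\<close> suffices once a route \<open>w\<close>, \<open>x\<close>,
  \<open>y\<close>, \<open>r\<close> avoids the only other vertex \<open>q\<close> that may be
  empty.\<close>

lemma big_far_few_zeros:
  assumes "\<not> solv C" "w \<in> Y - N r" "2 \<le> C w" "Z C \<subseteq> {r, q}"
  shows False
proof -
  have far: "\<not> (x \<in> N w \<and> y \<in> N x \<and> y \<in> N r \<and> x \<noteq> q \<and> y \<noteq> q)" for x y
  proof
    assume xy: "x \<in> N w \<and> y \<in> N x \<and> y \<in> N r \<and> x \<noteq> q \<and> y \<noteq> q"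
    then have s: "x \<in> X" "y \<in> Y" using assms(2) N_Y N_X root by blast+
    have "x \<noteq> r" using xy assms(2) N_sym[of w r] by auto
    moreover have "y \<noteq> r" using s root X_notin_Y by blast
    ultimately have "x \<notin> Z C" "y \<notin> Z C" using xy assms(4) by auto
    then have "1 \<le> C x" "1 \<le> C y" using s by (auto simp: mem_Z)
    then show False using solv_from_far[of w x y C] assms(1-3) xy by blast
  qed
  have two: "\<exists>u\<in>N v. u \<noteq> q" if "v \<in> X \<union> Y" for v
  proof (rule ccontr)
    assume "\<not> ?thesis"
    then have "N v \<subseteq> {q}" by blast
    then have "card (N v) \<le> 1" using card_mono[of "{q}" "N v"] by simp
    then show False using degree[OF that] large by simp
  qed
  show False
  \<comment> \<open>The intermediate vertex that could coincide with \<open>q\<close> is chosen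
    first, away from \<open>q\<close>; the other intermediate vertex differs from \<open>q\<close>
    because of its part.\<close>
  proof (cases "q \<in> Y")
    case True
    obtain y where y: "y \<in> N r" "y \<noteq> q" using two root by blast
    then have "y \<in> Y" using N_X root by blast
    then obtain x where x: "x \<in> N y" "x \<in> N w" using common_nbr[of y w] assms(2) by blast
    then have "x \<in> X" using N_Y assms(2) by blast
    then have "x \<noteq> q" using True X_notin_Y by blast
    then show False using far[of x y] x y N_sym[of x y] by blast
  next
    case False
    obtain x where x: "x \<in> N w" "x \<noteq> q" using two assms(2) by blast
    then have "x \<in> X" using N_Y assms(2) by blast
    then obtain y where y: "y \<in> N x" "y \<in> N r" using common_nbr[of x r] root by blast
    then have "y \<in> Y" using N_X root by blast
    then show False using far[of x y] x y False by blast
  qed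
qed

text \<open>Every common neighbour of \<open>v\<close> and \<open>r\<close> is empty, so
  \<open>q\<close> is the only one. A detour \<open>v\<close>, \<open>w\<close>, \<open>x\<close>,
  \<open>y\<close>, \<open>r\<close> with \<open>y\<close> different from \<open>q\<close> then runs
  through pebbled vertices.\<close>

lemma big_near_few_zeros:
  assumes "\<not> solv C" "v \<in> X" "2 \<le> C v" "Z C \<subseteq> {r, q}"
  shows False
proof -
  have vr: "N v \<inter> N r \<subseteq> {q}"
    using near_nbrs_zero[OF assms(1-3)] assms(4) N_neq[of r r] by blast
  have "card (Z C) \<le> card {r, q}" using assms(4) by (intro card_mono) auto
  also have "\<dots> \<le> 24" by (cases "r = q") auto
  finally obtain w where w: "w \<in> Y - N r" "w \<in> N v" "1 \<le> C w"
    using far_nbr[OF assms(1-3)] by blast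
  obtain q' where q': "q' \<in> N v" "q' \<in> N r" using common_nbr[of v r] assms(2) root by blast
  then have q: "q \<in> N r" "q \<in> Y" using vr N_X root by blast+
  have "\<not> N r \<subseteq> {q}"
  proof
    assume "N r \<subseteq> {q}"
    then have "card (N r) \<le> 1" using card_mono[of "{q}" "N r"] by simp
    then show False using degree[of r] root large by simp
  qed
  then obtain y where y: "y \<in> N r" "y \<noteq> q" by blast
  then have yY: "y \<in> Y" using N_X root by blast
  obtain x where x: "x \<in> N y" "x \<in> N w" using common_nbr[of y w] yY w(1) by blast
  have xX: "x \<in> X" using x(1) N_Y[OF yY] by blast
  \<comment> \<open>This separates \<open>x\<close> from \<open>v\<close>, whose pebbles the first
    move may use up.\<close>
  have "y \<notin> N v" using vr y by blast
  then have "x \<noteq> v" using x(1) N_sym[of y v] by blast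
  have "x \<noteq> r" using x(2) w(1) N_sym[of r w] by blast
  moreover have "x \<noteq> q" "y \<noteq> r" using q(2) xX yY root X_notin_Y by blast+
  ultimately have "x \<notin> Z C" "y \<notin> Z C" using assms(4) y(2) by auto
  then have pos: "1 \<le> C x" "1 \<le> C y" using xX yY by (auto simp: mem_Z)
  let ?C = "C(v := C v - 2 * 1, w := C w + 1)"
  have ne: "v \<noteq> w" "v \<noteq> y" "x \<noteq> w" using X_notin_Y assms(2) w(1) yY xX by auto
  have wy: "w \<noteq> y" using w(1) y(1) by blast
  have "solv ?C"
  proof (rule solv_from_far[of w x y])
    show "y \<in> N x" using x(1) N_sym by blast
    show "2 \<le> ?C w" "1 \<le> ?C x" "1 \<le> ?C y" using w(3) pos ne wy \<open>x \<noteq> v\<close> by auto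
  qed (use w(1) x(2) y(1) in auto)
  then show False using move[of w v 1 C] w(2) assms(1,3) by simp
qed

lemma root_solvable:
  assumes "config_size G C = 2 * m"
  shows "solv C"
proof (rule ccontr)
  assume uns: "\<not> solv C"
  let ?f = "\<lambda>v. C v div 2"
  have near: "?f y = 0" if "y \<in> N r" for y
  proof -
    have "\<not> 2 \<le> C y" using solv_two[OF that, of C] uns by blast
    then show ?thesis by simp
  qed
  have fin: "finite (X \<union> Y)" using finite_X finite_Y by simp
  have "sum ?f (X \<union> Y) = sum ?f X + sum ?f Y"
    using finite_X finite_Y disjoint by (rule sum.union_disjoint)
  moreover have "sum ?f Y = sum ?f (Y - N r)"
    using finite_Y near by (intro sum.mono_neutral_right) auto
  \<comment> \<open>At most 7 moves start in \<open>X\<close> and at most 5 in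
    \<open>Y - N r\<close>; none starts in \<open>N r\<close>.\<close>
  ultimately have U: "sum ?f (X \<union> Y) < 13"
    using near_weight[OF uns] far_weight[OF uns] by simp
  have Zle: "card (Z C) \<le> 2 * sum ?f (X \<union> Y)" by (rule card_Z_le[OF assms])
  then have few: "card (Z C) \<le> 24" using U by simp
  have "\<not> 1 \<le> C r" using uns r_solvableI[of C r G] by blast
  then have r0: "r \<in> Z C" using root by (simp add: mem_Z)
  have loc: "v \<in> X \<or> v \<in> Y - N r" if "v \<in> X \<union> Y" "2 \<le> C v" for v
  proof (rule ccontr)
    assume "\<not> ?thesis"
    then have "C v div 2 = 0" using near[of v] that(1) by blast
    then show False using that(2) by simp
  qed
  have "card (Z C) > 0" using r0 finite_Z card_gt_0_iff by blast
  \<comment> \<open>The empty root is a deficit, so at least one move is available.\<close>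
  then have "sum ?f (X \<union> Y) \<noteq> 0" using Zle by simp
  then obtain v where v: "v \<in> X \<union> Y" "?f v \<noteq> 0" by (meson sum.neutral)
  then have v2: "2 \<le> C v" by (simp add: div_eq_0_iff)
  have small: "?f w < 2" if w: "w \<in> X \<union> Y" for w
  proof (rule ccontr)
    assume "\<not> ?thesis"
    then have w4: "4 \<le> C w" by linarith
    then consider "w \<in> X" | "w \<in> Y - N r" using loc[OF w] by force
    then show False
    proof cases
      case 1
      then show False using solv_four w4 uns by blast
    next
      case 2
      then show False using solv_two_far[of w w C] w4 few uns by simp
    qed
  qed
  have only: "?f w = 0" if w: "w \<in> X \<union> Y" "w \<noteq> v" for w
  proof (rule ccontr)
    assume "?f w \<noteq> 0"
    then have w2: "2 \<le> C w" by (simp add: div_eq_0_iff)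
    consider "v \<in> X" "w \<in> X" | "v \<in> X" "w \<in> Y - N r" | "v \<in> Y - N r" "w \<in> X"
      | "v \<in> Y - N r" "w \<in> Y - N r"
      using loc[OF v(1) v2] loc[OF w(1) w2] by blast
    then show False
    proof cases
      case 1
      then show False using big_near_near[OF uns few, of v w] v2 w2 w(2) by blast
    next
      case 2
      then show False using big_near_far[OF uns few, of v w] v2 w2 by blast
    next
      case 3
      then show False using big_near_far[OF uns few, of w v] v2 w2 by blast
    next
      case 4
      have "solv C" by (rule solv_two_far[of v w]) (use 4 v2 w2 w(2) few in auto)
      then show False using uns by blast
    qed
  qed
  \<comment> \<open>Exactly one move remains, which leaves at most two empty vertices:
    \<open>r\<close> and possibly \<open>q\<close>.\<close>
  have "sum ?f (X \<union> Y) = ?f v + sum ?f (X \<union> Y - {v})"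
    using fin v(1) by (rule sum.remove)
  moreover have "sum ?f (X \<union> Y - {v}) = 0" using only by (intro sum.neutral) blast
  ultimately have "card (Z C) \<le> 2" using Zle small[OF v(1)] by simp
  then have "card (Z C - {r}) \<le> Suc 0" using r0 finite_Z by simp
  then have one: "\<forall>a\<in>Z C - {r}. \<forall>b\<in>Z C - {r}. a = b"
    using card_le_Suc0_iff_eq[of "Z C - {r}"] finite_Z by blast
  obtain q where q: "Z C \<subseteq> {r, q}"
  proof (cases "Z C - {r} = {}")
    case True
    then show ?thesis using that[of r] by blast
  next
    case False
    then show ?thesis using that one by blast
  qed
  from loc[OF v(1) v2] show False
  proof
    assume "v \<in> X"
    then show False using big_near_few_zeros[OF uns _ v2 q] by blast
  next
    assume "v \<in> Y - N r"
    then show False using big_far_few_zeros[OF uns _ v2 q] by blast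
  qed
qed

end

lemma out_degree_eq_card_nbrs: "out_degree (with_proj G) v = card (nbrs G v)"
proof -
  have "out_arcs (with_proj G) v = Pair v ` nbrs G v"
    by (auto simp: out_arcs_def nbrs_def)
  then show ?thesis
    unfolding out_degree_def by (simp add: card_image inj_on_def)
qed

lemma class_0_if_dense:
  fixes G :: "'a pair_pre_digraph"
  assumes "336 \<le> m" "G \<in> conn_bipartite m" "m div 2 + 1 \<le> min_degree G"
  shows "class_0 G"
proof -
  obtain X Y where G: "pair_graph G" "connected (with_proj G)"
    and V: "pverts G = X \<union> Y" "X \<inter> Y = {}" "card X = m" "card Y = m"
    and E: "parcs G \<subseteq> X \<times> Y \<union> Y \<times> X"
    using assms(2) unfolding conn_bipartite_def by blast
  interpret pair_graph G by fact
  have sym: "(v, u) \<in> parcs G" if "(u, v) \<in> parcs G" for u v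
    using arcs_ends_symmetric[OF pair_sym_arcs] that by simp
  have deg: "m < 2 * card (nbrs G v)" if "v \<in> X \<union> Y" for v
  proof -
    have "min_degree G \<le> card (nbrs G v)"
      unfolding min_degree_def out_degree_eq_card_nbrs
      using pair_finite_verts that V(1) by (intro Min_le) auto
    then show ?thesis using assms(3) by linarith
  qed
  have "rooted_dense_bipartite G X Y m r" if "r \<in> X" for r
    by unfold_locales (use sym V E assms(1) deg that in auto)
  moreover have "rooted_dense_bipartite G Y X m r" if "r \<in> Y" for r
    by unfold_locales (use sym V E assms(1) deg that in auto)
  ultimately have "r_solvable G r C" if "r \<in> pverts G" "config_size G C = 2 * m" for r C
    using that V(1) rooted_dense_bipartite.root_solvable by (metis UnE)
  moreover have "card (pverts G) = 2 * m"
    using V assms(1) by (simp add: card_Un_disjoint card_ge_0_finite)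
  ultimately show ?thesis
    unfolding class_0_iff[OF G] solvable_def by simp
qed

section \<open>Two complete bipartite blocks joined by a bridge\<close>

context
  fixes m :: nat
  assumes m: "2 \<le> m"
begin

text \<open>The parts are \<open>{0..<m}\<close> and \<open>{m..<2 * m}\<close>. The smaller side of
  the first block lies in the first part and that of the second block in the second part, so odd
  \<open>m\<close> also gives parts of size \<open>m\<close> and degrees at least
  \<open>m div 2\<close>. The pair \<open>(m div 2, m)\<close> is the bridge.\<close>

definition block_arcs :: "(nat \<times> nat) set" where
  "block_arcs = {0..<m div 2} \<times> {m..<2 * m - m div 2} \<union>
     {m div 2..<m} \<times> {2 * m - m div 2..<2 * m} \<union> {(m div 2, m)}"

definition bridge_graph :: "nat pair_pre_digraph" where
  "bridge_graph = \<lparr>pverts = {0..<2 * m}, parcs = block_arcs \<union> block_arcs\<inverse>\<rparr>"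

lemma bridge_graph_simps:
  "pverts bridge_graph = {0..<2 * m}" "parcs bridge_graph = block_arcs \<union> block_arcs\<inverse>"
  by (simp_all add: bridge_graph_def)

lemma block_arcs_subset: "block_arcs \<subseteq> {0..<m} \<times> {m..<2 * m}"
  using m unfolding block_arcs_def by auto

lemma pair_graph_bridge: "pair_graph bridge_graph"
proof
  show "finite (parcs bridge_graph)"
    unfolding bridge_graph_simps using finite_subset[OF block_arcs_subset] by simp
  show "symmetric (with_proj bridge_graph)"
    by (auto simp: symmetric_def sym_def bridge_graph_simps)
  fix e assume "e \<in> parcs bridge_graph"
  then have e: "e \<in> {0..<m} \<times> {m..<2 * m} \<union> {m..<2 * m} \<times> {0..<m}"
    using block_arcs_subset unfolding bridge_graph_simps by blast
  then show "fst e \<in> pverts bridge_graph" "snd e \<in> pverts bridge_graph" "fst e \<noteq> snd e"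
    unfolding bridge_graph_simps by auto
qed (simp add: bridge_graph_simps)

lemma connected_bridge: "connected (with_proj bridge_graph)"
proof -
  interpret pair_graph bridge_graph by (rule pair_graph_bridge)
  have arc: "u \<rightarrow>\<^sup>*\<^bsub>with_proj bridge_graph\<^esub> v"
    if "(u, v) \<in> block_arcs \<or> (v, u) \<in> block_arcs" for u v
    using that by (intro reachable_adjI) (auto simp: bridge_graph_simps)
  \<comment> \<open>The bridge end \<open>m\<close> serves as a hub; symmetry then joins any two
    vertices.\<close>
  have hub: "v \<rightarrow>\<^sup>*\<^bsub>with_proj bridge_graph\<^esub> m" if v: "v < 2 * m" for v
  proof -
    consider "v < m div 2" | "m div 2 \<le> v" "v < m" | "m \<le> v" "v < 2 * m - m div 2"
      | "2 * m - m div 2 \<le> v" using v by linarith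
    then show ?thesis
    proof cases
      case 1
      then show ?thesis using m by (intro arc) (auto simp: block_arcs_def)
    next
      case 2
      have "v \<rightarrow>\<^sup>*\<^bsub>with_proj bridge_graph\<^esub> (2 * m - m div 2)"
        "(2 * m - m div 2) \<rightarrow>\<^sup>*\<^bsub>with_proj bridge_graph\<^esub> (m div 2)"
        "(m div 2) \<rightarrow>\<^sup>*\<^bsub>with_proj bridge_graph\<^esub> m"
        using 2 m by (intro arc; auto simp: block_arcs_def)+
      then show ?thesis by (meson reachable_trans)
    next
      case 3
      have "v \<rightarrow>\<^sup>*\<^bsub>with_proj bridge_graph\<^esub> 0" "0 \<rightarrow>\<^sup>*\<^bsub>with_proj bridge_graph\<^esub> m"
        using 3 m by (intro arc; auto simp: block_arcs_def)+
      then show ?thesis by (meson reachable_trans)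
    next
      case 4
      have "v \<rightarrow>\<^sup>*\<^bsub>with_proj bridge_graph\<^esub> (m div 2)"
        "(m div 2) \<rightarrow>\<^sup>*\<^bsub>with_proj bridge_graph\<^esub> m"
        using 4 v m by (intro arc; auto simp: block_arcs_def)+
      then show ?thesis by (meson reachable_trans)
    qed
  qed
  have "u \<rightarrow>\<^sup>*\<^bsub>with_proj bridge_graph\<^esub> v" if "u < 2 * m" "v < 2 * m" for u v
    using hub[OF that(1)] symmetric_reachable'[OF hub[OF that(2)]] by (rule reachable_trans)
  then show ?thesis
    unfolding connected_def strongly_connected_def using m
    by (auto simp: bridge_graph_simps intro!: reachable_mk_symmetricI)
qed

lemma bridge_conn_bipartite: "bridge_graph \<in> conn_bipartite m"
proof -
  have "parcs bridge_graph \<subseteq> {0..<m} \<times> {m..<2 * m} \<union> {m..<2 * m} \<times> {0..<m}"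
    using block_arcs_subset unfolding bridge_graph_simps by blast
  moreover have "pverts bridge_graph = {0..<m} \<union> {m..<2 * m}"
    unfolding bridge_graph_simps by auto
  ultimately show ?thesis
    unfolding conn_bipartite_def using pair_graph_bridge connected_bridge
    by (intro CollectI conjI exI[of _ "{0..<m}"] exI[of _ "{m..<2 * m}"]) auto
qed

lemma min_degree_bridge: "m div 2 \<le> min_degree bridge_graph"
proof -
  interpret pair_graph bridge_graph by (rule pair_graph_bridge)
  have "m div 2 \<le> card (nbrs bridge_graph v)" if v: "v < 2 * m" for v
  proof -
    have fin: "finite (nbrs bridge_graph v)"
      by (rule finite_subset[OF _ pair_finite_verts]) (auto simp: nbrs_def in_arcsD2)
    consider "v < m div 2" | "m div 2 \<le> v" "v < m" | "m \<le> v" "v < 2 * m - m div 2"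
      | "2 * m - m div 2 \<le> v" using v by linarith
    then obtain S where "S \<subseteq> nbrs bridge_graph v" "m div 2 \<le> card S"
    proof cases
      case 1
      then show ?thesis
        by (intro that[of "{m..<2 * m - m div 2}"])
          (auto simp: nbrs_def bridge_graph_simps block_arcs_def)
    next
      case 2
      then show ?thesis
        by (intro that[of "{2 * m - m div 2..<2 * m}"])
          (auto simp: nbrs_def bridge_graph_simps block_arcs_def)
    next
      case 3
      then show ?thesis
        by (intro that[of "{0..<m div 2}"])
          (auto simp: nbrs_def bridge_graph_simps block_arcs_def)
    next
      case 4
      then show ?thesis using v
        by (intro that[of "{m div 2..<m}"])
          (auto simp: nbrs_def bridge_graph_simps block_arcs_def)
    qed
    then show ?thesis using card_mono[OF fin] le_trans by blast
  qed
  then show ?thesis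
    unfolding min_degree_def out_degree_eq_card_nbrs using m
    by (subst Min_ge_iff) (auto simp: bridge_graph_simps)
qed

text \<open>This is the block away from the root 0; it contains the bridge end
  \<open>m div 2\<close> but not \<open>m\<close>.\<close>

definition far_block :: "nat set" where
  "far_block = {m div 2..<m} \<union> {2 * m - m div 2..<2 * m}"

text \<open>Before the bridge is crossed only one vertex of the far block can move; a single pebble
  reaches \<open>m\<close>, and after that no move is left.\<close>

definition stuck :: "(nat \<Rightarrow> nat) \<Rightarrow> bool" where
  "stuck D \<longleftrightarrow> D 0 = 0 \<and> ((\<forall>v. D v \<le> 1) \<or>
     (D m = 0 \<and> (\<exists>u\<in>far_block. D u \<le> 3 \<and> (\<forall>v. v \<noteq> u \<longrightarrow> D v \<le> 1))))"

text \<open>The unique movable vertex drops to at most one pebble. A target in the far block rises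
  to at most two and becomes the new exception; the only other possible target is the empty vertex
  \<open>m\<close>, after which no vertex has two pebbles.\<close>

lemma stuck_step:
  assumes "stuck C" "pebbling_step bridge_graph C D"
  shows "stuck D"
proof -
  obtain u v where uv: "(u, v) \<in> block_arcs \<or> (v, u) \<in> block_arcs" "2 \<le> C u"
    and D: "D = C(u := C u - 2, v := C v + 1)"
    using assms(2) unfolding pebbling_step_def bridge_graph_simps by auto
  have C: "C 0 = 0" "C m = 0" "u \<in> far_block" "C u \<le> 3" "\<And>w. w \<noteq> u \<Longrightarrow> C w \<le> 1"
  proof -
    have "\<not> C u \<le> 1" using uv(2) by simp
    then obtain w where w: "w \<in> far_block" "C w \<le> 3" "\<forall>v. v \<noteq> w \<longrightarrow> C v \<le> 1"
      "C 0 = 0" "C m = 0"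
      using assms(1) unfolding stuck_def by blast
    moreover from this have "u = w" using \<open>\<not> C u \<le> 1\<close> by blast
    ultimately show "C 0 = 0" "C m = 0" "u \<in> far_block" "C u \<le> 3" "\<And>w. w \<noteq> u \<Longrightarrow> C w \<le> 1"
      by blast+
  qed
  have ne: "0 \<notin> far_block" "m \<notin> far_block" "m \<noteq> 0"
    using m by (auto simp: far_block_def)
  have "v \<noteq> u" using uv(1) block_arcs_subset by force
  have "v \<in> far_block \<or> v = m"
    using uv(1) C(3) m by (auto simp: block_arcs_def far_block_def)
  then show ?thesis
  proof
    assume "v = m"
    then have "\<forall>w. D w \<le> 1" "D 0 = 0"
      unfolding D using C ne by auto
    then show ?thesis unfolding stuck_def by blast
  next
    assume v: "v \<in> far_block"
    then have "v \<noteq> 0" "v \<noteq> m" "u \<noteq> 0" "u \<noteq> m" using C(3) ne by metis+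
    then have "D 0 = 0" "D m = 0" unfolding D using C(1,2) by simp_all
    moreover have "D v \<le> 3" unfolding D using C(5)[OF \<open>v \<noteq> u\<close>] by simp
    moreover have "D w \<le> 1" if "w \<noteq> v" for w
      unfolding D using C(4) C(5)[of w] that by (cases "w = u") auto
    ultimately show ?thesis unfolding stuck_def using v by blast
  qed
qed

lemma stuck_not_solvable:
  assumes "stuck C"
  shows "\<not> r_solvable bridge_graph 0 C"
proof -
  have "stuck D" if "(pebbling_step bridge_graph)\<^sup>*\<^sup>* C D" for D
    using that
  proof (induction rule: rtranclp_induct)
    case base
    show ?case by (rule assms)
  next
    case (step D E)
    show ?case by (rule stuck_step) fact+
  qed
  then have "D 0 = 0" if "(pebbling_step bridge_graph)\<^sup>*\<^sup>* C D" for D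
    using that unfolding stuck_def by blast
  then show ?thesis unfolding r_solvable_def by force
qed

lemma not_class_0_bridge: "\<not> class_0 bridge_graph"
proof
  assume "class_0 bridge_graph"
  then have all: "\<And>C. config_size bridge_graph C = 2 * m \<Longrightarrow> solvable bridge_graph C"
    using class_0_iff[OF pair_graph_bridge connected_bridge] by (simp add: bridge_graph_simps)
  \<comment> \<open>The two extra pebbles on \<open>m div 2\<close> make up for the empty vertices 0
    and \<open>m\<close>, so the size is exactly \<open>2 * m\<close>.\<close>
  define C where "C = (\<lambda>v. if v = 0 \<or> v = m then 0 else if v = m div 2 then 3 else 1 :: nat)"
  have "{0..<2 * m} = {0, m, m div 2} \<union> ({0..<2 * m} - {0, m, m div 2})"
    using m by auto
  then have "config_size bridge_graph C
      = sum C ({0, m, m div 2} \<union> ({0..<2 * m} - {0, m, m div 2}))"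
    unfolding config_size_def bridge_graph_simps by simp
  also have "\<dots> = sum C {0, m, m div 2} + sum C ({0..<2 * m} - {0, m, m div 2})"
    by (rule sum.union_disjoint) auto
  also have "sum C ({0..<2 * m} - {0, m, m div 2}) = (\<Sum>v\<in>{0..<2 * m} - {0, m, m div 2}. 1)"
    by (rule sum.cong) (auto simp: C_def)
  also have "\<dots> = 2 * m - card {0, m, m div 2}"
    using m by (simp add: card_Diff_subset del: card_insert_disjoint)
  also have "card {0, m, m div 2} = 3" using m by auto
  also have "sum C {0, m, m div 2} = 3" using m by (auto simp: C_def)
  finally have "config_size bridge_graph C = 2 * m" using m by simp
  then have "r_solvable bridge_graph 0 C"
    using all m unfolding solvable_def bridge_graph_simps by auto
  moreover have "stuck C"
    unfolding stuck_def C_def far_block_def using m by (auto intro!: bexI[of _ "m div 2"])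
  ultimately show False using stuck_not_solvable by blast
qed

end

theorem theorem1:
  fixes m :: nat
  assumes "336 \<le> m"
  shows "class_0_threshold m = m div 2 + 1 \<and>
    (\<forall>G :: 'a pair_pre_digraph.
       G \<in> conn_bipartite m \<and> m div 2 + 1 \<le> min_degree G \<longrightarrow> class_0 G) \<and>
    (\<exists>G :: nat pair_pre_digraph.
       G \<in> conn_bipartite m \<and> m div 2 \<le> min_degree G \<and> \<not> class_0 G)"
proof -
  have m: "2 \<le> m" using assms by simp
  note bridge = bridge_conn_bipartite[OF m] min_degree_bridge[OF m] not_class_0_bridge[OF m]
  have "class_0_threshold m = m div 2 + 1"
    unfolding class_0_threshold_def
  proof (rule Least_equality)
    show "\<forall>G :: nat pair_pre_digraph.
        G \<in> conn_bipartite m \<and> m div 2 + 1 \<le> min_degree G \<longrightarrow> class_0 G"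
      using class_0_if_dense[OF assms] by blast
  next
    fix b
    assume b: "\<forall>G :: nat pair_pre_digraph.
        G \<in> conn_bipartite m \<and> b \<le> min_degree G \<longrightarrow> class_0 G"
    show "m div 2 + 1 \<le> b"
    proof (rule ccontr)
      assume "\<not> ?thesis"
      \<comment> \<open>A threshold of at most \<open>m div 2\<close> would also cover the bridge
        graph.\<close>
      then have "b \<le> min_degree (bridge_graph m)" using bridge(2) by linarith
      then show False using b bridge(1,3) by blast
    qed
  qed
  then show ?thesis using class_0_if_dense[OF assms] bridge by blast
qed

end
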